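(* Let $(X,E)$ be a simplicial complex and $(Y,c_Y)$ a closure space. Given a set map $f:X\to Y$, $f:(X,\mathrm{St}(E))\to(Y,c_Y)$ is a continuous map if and only if $f:(X,E)\to(Y,\mathrm{VR}(c_Y))$ is a simplicial map. Thus there is a natural isomorphism $$\mathbf{Cl}\big((X,\mathrm{St}(E)),(Y,c_Y)\big)\cong\mathbf{Simp}\big((X,E),(Y,\mathrm{VR}(c_Y))\big).$$ That is, $\mathrm{VR}:\mathbf{Cl}\to\mathbf{Simp}$ is right adjoint to $\mathrm{St}:\mathbf{Simp}\to\mathbf{Cl}$.
   Context: A (Čech) closure space $(X,c)$ is a set $X$ with a function $c:2^X\to 2^X$ such that $c(\varnothing)=\varnothing$, $A\subset c(A)$, and $c(A\cup B)=c(A)\cup c(B)$. Write $c(x)$ for $c(\{x\})$. Continuous maps $f:(X,c_X)\to(Y,c_Y)$ satisfy $f(c_X(A))\subset c_Y(f(A))$ for all $A\subset X$; $\mathbf{Cl}$ is the resulting category. A simplicial complex $(X,E)$ is a set $X$ with a collection $E$ of nonempty finite subsets of $X$ (simplices) containing all singletons and closed under nonempty subsets. A simplicial map $f:(X,E)\to(Y,F)$ is a map $f:X\to Y$ with $f(\sigma)\in F$ for all $\sigma\in E$; $\mathbf{Simp}$ is the resulting category. $\mathrm{VR}:\mathbf{Cl}\to\mathbf{Simp}$ sends $(X,c)$ to $(X,\mathrm{VR}(c))$, where $\mathrm{VR}(c)$ is the set of nonempty finite $\sigma\subset X$ such that $\sigma\subset c(x)$ for all $x\in\sigma$. $\mathrm{St}:\mathbf{Simp}\to\mathbf{Cl}$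 sends $(X,E)$ to $(X,\mathrm{St}(E))$, where $\mathrm{St}(E)(A)$ is the union of all simplices in $E$ that intersect $A$. Both functors are the identity on underlying set maps. *)

theory Defs
  imports Main "HOL-Library.FuncSet"
begin

section \<open>Closure spaces and simplicial complexes\<close>

definition closure_space :: "'a set \<Rightarrow> ('a set \<Rightarrow> 'a set) \<Rightarrow> bool" where
  "closure_space X c \<longleftrightarrow>
     c \<in> Pow X \<rightarrow> Pow X \<and>
     c {} = {} \<and>
     (\<forall>A\<subseteq>X. A \<subseteq> c A) \<and>
     (\<forall>A\<subseteq>X. \<forall>B\<subseteq>X. c (A \<union> B) = c A \<union> c B)"

definition closure_continuous ::
  "'a set \<Rightarrow> ('a set \<Rightarrow> 'a set) \<Rightarrow> 'b set \<Rightarrow> ('b set \<Rightarrow> 'b set) \<Rightarrow> ('a \<Rightarrow> 'b) \<Rightarrow> bool" where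
  "closure_continuous X c Y d f \<longleftrightarrow> f \<in> X \<rightarrow> Y \<and> (\<forall>A\<subseteq>X. f ` c A \<subseteq> d (f ` A))"

definition simplicial_complex :: "'a set \<Rightarrow> 'a set set \<Rightarrow> bool" where
  "simplicial_complex X E \<longleftrightarrow>
     (\<forall>\<sigma>\<in>E. \<sigma> \<noteq> {} \<and> finite \<sigma> \<and> \<sigma> \<subseteq> X) \<and>
     (\<forall>x\<in>X. {x} \<in> E) \<and>
     (\<forall>\<sigma>\<in>E. \<forall>\<tau>. \<tau> \<noteq> {} \<and> \<tau> \<subseteq> \<sigma> \<longrightarrow> \<tau> \<in> E)"

definition simplicial_map ::
  "'a set \<Rightarrow> 'a set set \<Rightarrow> 'b set \<Rightarrow> 'b set set \<Rightarrow> ('a \<Rightarrow> 'b) \<Rightarrow> bool" where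
  "simplicial_map X E Y F f \<longleftrightarrow> f \<in> X \<rightarrow> Y \<and> (\<forall>\<sigma>\<in>E. f ` \<sigma> \<in> F)"

definition VR :: "'a set \<Rightarrow> ('a set \<Rightarrow> 'a set) \<Rightarrow> 'a set set" where
  "VR X c = {\<sigma>. \<sigma> \<noteq> {} \<and> finite \<sigma> \<and> \<sigma> \<subseteq> X \<and> (\<forall>x\<in>\<sigma>. \<sigma> \<subseteq> c {x})}"

definition St :: "'a set \<Rightarrow> 'a set set \<Rightarrow> 'a set \<Rightarrow> 'a set" where
  "St X E = (\<lambda>A\<in>Pow X. \<Union>{\<sigma>\<in>E. \<sigma> \<inter> A \<noteq> {}})"


section \<open>Categories, functors and adjunctions\<close>

text \<open>
  \<open>Comp C x y z g f\<close> is the composite of \<open>f : x \<rightarrow> y\<close> and \<open>g : y \<rightarrow> z\<close>. The objects are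
  arguments because the composite of set maps has to be restricted to the carrier of \<open>x\<close>,
  which cannot be recovered from the underlying HOL function.
\<close>

record ('o, 'm) category =
  Ob :: "'o set"
  Hom :: "'o \<Rightarrow> 'o \<Rightarrow> 'm set"
  Ident :: "'o \<Rightarrow> 'm"
  Comp :: "'o \<Rightarrow> 'o \<Rightarrow> 'o \<Rightarrow> 'm \<Rightarrow> 'm \<Rightarrow> 'm"

definition is_category :: "('o, 'm) category \<Rightarrow> bool" where
  "is_category C \<longleftrightarrow>
     (\<forall>x\<in>Ob C. Ident C x \<in> Hom C x x) \<and>
     (\<forall>x\<in>Ob C. \<forall>y\<in>Ob C. \<forall>z\<in>Ob C. \<forall>f\<in>Hom C x y. \<forall>g\<in>Hom C y z.
        Comp C x y z g f \<in> Hom C x z) \<and>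
     (\<forall>x\<in>Ob C. \<forall>y\<in>Ob C. \<forall>f\<in>Hom C x y.
        Comp C x x y f (Ident C x) = f \<and> Comp C x y y (Ident C y) f = f) \<and>
     (\<forall>w\<in>Ob C. \<forall>x\<in>Ob C. \<forall>y\<in>Ob C. \<forall>z\<in>Ob C.
        \<forall>f\<in>Hom C w x. \<forall>g\<in>Hom C x y. \<forall>h\<in>Hom C y z.
        Comp C w x z (Comp C x y z h g) f = Comp C w y z h (Comp C w x y g f))"

record ('o1, 'm1, 'o2, 'm2) cat_functor =
  ob_map :: "'o1 \<Rightarrow> 'o2"
  hom_map :: "'o1 \<Rightarrow> 'o1 \<Rightarrow> 'm1 \<Rightarrow> 'm2"

definition is_functor ::
  "('o1, 'm1) category \<Rightarrow> ('o2, 'm2) category \<Rightarrow> ('o1, 'm1, 'o2, 'm2) cat_functor \<Rightarrow> bool" where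
  "is_functor C D F \<longleftrightarrow>
     is_category C \<and> is_category D \<and>
     (\<forall>x\<in>Ob C. ob_map F x \<in> Ob D) \<and>
     (\<forall>x\<in>Ob C. \<forall>y\<in>Ob C. \<forall>f\<in>Hom C x y.
        hom_map F x y f \<in> Hom D (ob_map F x) (ob_map F y)) \<and>
     (\<forall>x\<in>Ob C. hom_map F x x (Ident C x) = Ident D (ob_map F x)) \<and>
     (\<forall>x\<in>Ob C. \<forall>y\<in>Ob C. \<forall>z\<in>Ob C. \<forall>f\<in>Hom C x y. \<forall>g\<in>Hom C y z.
        hom_map F x z (Comp C x y z g f) =
        Comp D (ob_map F x) (ob_map F y) (ob_map F z) (hom_map F y z g) (hom_map F x y f))"

text \<open>
  \<open>adjunction C D F G \<phi>\<close>: the functor \<open>G : D \<rightarrow> C\<close> is right adjoint to \<open>F : C \<rightarrow> D\<close>, by means of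
  the bijections \<open>\<phi> x y : D(F x, y) \<rightarrow> C(x, G y)\<close>, natural in \<open>x\<close> and \<open>y\<close>:
  \<open>\<phi> (g \<circ> f \<circ> F h) = G g \<circ> \<phi> f \<circ> h\<close> for \<open>h : x' \<rightarrow> x\<close>, \<open>f : F x \<rightarrow> y\<close> and \<open>g : y \<rightarrow> y'\<close>.
\<close>

definition adjunction ::
  "('o1, 'm1) category \<Rightarrow> ('o2, 'm2) category \<Rightarrow>
   ('o1, 'm1, 'o2, 'm2) cat_functor \<Rightarrow> ('o2, 'm2, 'o1, 'm1) cat_functor \<Rightarrow>
   ('o1 \<Rightarrow> 'o2 \<Rightarrow> 'm2 \<Rightarrow> 'm1) \<Rightarrow> bool" where
  "adjunction C D F G \<phi> \<longleftrightarrow>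
     is_functor C D F \<and> is_functor D C G \<and>
     (\<forall>x\<in>Ob C. \<forall>y\<in>Ob D. bij_betw (\<phi> x y) (Hom D (ob_map F x) y) (Hom C x (ob_map G y))) \<and>
     (\<forall>x\<in>Ob C. \<forall>x'\<in>Ob C. \<forall>y\<in>Ob D. \<forall>y'\<in>Ob D.
        \<forall>h\<in>Hom C x' x. \<forall>g\<in>Hom D y y'. \<forall>f\<in>Hom D (ob_map F x) y.
        \<phi> x' y' (Comp D (ob_map F x') (ob_map F x) y'
                   (Comp D (ob_map F x) y y' g f) (hom_map F x' x h)) =
        Comp C x' x (ob_map G y')
          (Comp C x (ob_map G y) (ob_map G y') (hom_map G y y' g) (\<phi> x y f)) h)"


section \<open>The categories Cl and Simp, the functors St and VR\<close>

text \<open>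
  Set maps are represented by functions that are \<open>undefined\<close> outside their domain, so that equality
  of morphisms, and of closure operators, is equality of functions on the carrier.
  The hom-sets, and the actions of \<open>St\<close> and \<open>VR\<close>, are defined for carriers in possibly
  different types; the categories consist of the objects with carrier in a fixed type.
\<close>

type_synonym 'a clos = "'a set \<times> ('a set \<Rightarrow> 'a set)"
type_synonym 'a simp = "'a set \<times> 'a set set"

definition Cl_hom :: "'a clos \<Rightarrow> 'b clos \<Rightarrow> ('a \<Rightarrow> 'b) set" where
  "Cl_hom P Q = {f \<in> extensional (fst P). closure_continuous (fst P) (snd P) (fst Q) (snd Q) f}"

definition Simp_hom :: "'a simp \<Rightarrow> 'b simp \<Rightarrow> ('a \<Rightarrow> 'b) set" where
  "Simp_hom P Q = {f \<in> extensional (fst P). simplicial_map (fst P) (snd P) (fst Q) (snd Q) f}"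

definition Cl :: "('a clos, 'a \<Rightarrow> 'a) category" where
  "Cl = \<lparr>Ob = {(X, c). closure_space X c \<and> c \<in> extensional (Pow X)},
         Hom = Cl_hom,
         Ident = (\<lambda>P. \<lambda>x\<in>fst P. x),
         Comp = (\<lambda>P Q R g f. compose (fst P) g f)\<rparr>"

definition Simp :: "('a simp, 'a \<Rightarrow> 'a) category" where
  "Simp = \<lparr>Ob = {(X, E). simplicial_complex X E},
           Hom = Simp_hom,
           Ident = (\<lambda>P. \<lambda>x\<in>fst P. x),
           Comp = (\<lambda>P Q R g f. compose (fst P) g f)\<rparr>"

definition St_ob :: "'a simp \<Rightarrow> 'a clos" where
  "St_ob P = (fst P, St (fst P) (snd P))"

definition VR_ob :: "'a clos \<Rightarrow> 'a simp" where
  "VR_ob P = (fst P, VR (fst P) (snd P))"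

definition St_hom :: "'a simp \<Rightarrow> 'b simp \<Rightarrow> ('a \<Rightarrow> 'b) \<Rightarrow> ('a \<Rightarrow> 'b)" where
  "St_hom P Q f = f"

definition VR_hom :: "'a clos \<Rightarrow> 'b clos \<Rightarrow> ('a \<Rightarrow> 'b) \<Rightarrow> ('a \<Rightarrow> 'b)" where
  "VR_hom P Q f = f"

definition St_functor :: "('a simp, 'a \<Rightarrow> 'a, 'a clos, 'a \<Rightarrow> 'a) cat_functor" where
  "St_functor = \<lparr>ob_map = St_ob, hom_map = St_hom\<rparr>"

definition VR_functor :: "('a clos, 'a \<Rightarrow> 'a, 'a simp, 'a \<Rightarrow> 'a) cat_functor" where
  "VR_functor = \<lparr>ob_map = VR_ob, hom_map = VR_hom\<rparr>"

text \<open>The comparison of hom-sets: it leaves the underlying set map unchanged.\<close>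

definition St_VR_iso :: "'a simp \<Rightarrow> 'b clos \<Rightarrow> ('a \<Rightarrow> 'b) \<Rightarrow> ('a \<Rightarrow> 'b)" where
  "St_VR_iso P Q f = f"

end

theory Submission imports Defs begin

text \<open>
  Both directions of the equivalence rest on the case of singletons: a simplex \<open>\<sigma>\<close> containing \<open>x\<close>
  lies in \<open>St(E)(x)\<close>, so continuity sends it into \<open>c(f x)\<close>; conversely, if the image of \<open>\<sigma>\<close> lies in
  \<open>c(f x)\<close> for some \<open>x \<in> \<sigma> \<inter> A\<close>, then it lies in \<open>c(f(A))\<close> because \<open>c\<close> is monotone.
  All functors and the comparison map are the identity on underlying maps, so naturality is an
  identity between composites of functions.
\<close>

section \<open>Closure operators, and the objects produced by \<open>St\<close> and
  \<open>VR\<close>\<close>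

lemma closure_spaceD:
  assumes "closure_space X c"
  shows closure_space_subset: "A \<subseteq> X \<Longrightarrow> c A \<subseteq> X"
    and closure_space_extensive: "A \<subseteq> X \<Longrightarrow> A \<subseteq> c A"
    and closure_space_Un: "A \<subseteq> X \<Longrightarrow> B \<subseteq> X \<Longrightarrow> c (A \<union> B) = c A \<union> c B"
  using assms unfolding closure_space_def by auto

text \<open>Monotonicity comes from additivity: if A lies in B, then A \<union> B = B, so c(B) =
  c(A) \<union> c(B).\<close>

lemma closure_space_mono:
  assumes "closure_space X c" "A \<subseteq> B" "B \<subseteq> X"
  shows "c A \<subseteq> c B"
  using closure_space_Un[OF assms(1), of A B] assms(2,3) by (auto simp: Un_absorb1)

text \<open>The value of \<open>St X E\<close> is meaningful only on subsets of X, since the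
  operator is restricted to \<open>Pow X\<close>; this form lets later proofs avoid the
  restriction.\<close>

lemma mem_St_iff: "A \<subseteq> X \<Longrightarrow> y \<in> St X E A \<longleftrightarrow> (\<exists>\<sigma>\<in>E. y \<in> \<sigma> \<and> \<sigma> \<inter> A \<noteq> {})"
  unfolding St_def by auto

text \<open>Extensivity uses the simplex {x} around each point x of A. Additivity holds because a
  simplex meets A \<union> B exactly when it meets A or B.\<close>

lemma closure_space_St:
  assumes "simplicial_complex X E"
  shows "closure_space X (St X E)"
  unfolding closure_space_def
proof (intro conjI allI impI)
  have sub: "\<And>\<sigma>. \<sigma> \<in> E \<Longrightarrow> \<sigma> \<subseteq> X" and single: "\<And>x. x \<in> X \<Longrightarrow> {x} \<in> E"
    using assms unfolding simplicial_complex_def by blast+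
  show "St X E \<in> Pow X \<rightarrow> Pow X"
    using sub by (fastforce simp: mem_St_iff)
  show "St X E {} = {}"
    by (auto simp: mem_St_iff)
  show "A \<subseteq> St X E A" if "A \<subseteq> X" for A
  proof
    fix x assume "x \<in> A"
    with that single[of x] show "x \<in> St X E A"
      by (auto simp: mem_St_iff intro!: bexI[of _ "{x}"])
  qed
  show "St X E (A \<union> B) = St X E A \<union> St X E B" if "A \<subseteq> X" "B \<subseteq> X" for A B
    using that by (auto simp: mem_St_iff set_eq_iff)
qed

text \<open>Extensivity of c makes each singleton a simplex. Passing to a face leaves fewer points x
  to test and a smaller set to fit into c(x).\<close>

lemma simplicial_complex_VR:
  assumes "closure_space X c"
  shows "simplicial_complex X (VR X c)"
proof -
  have "{x} \<in> VR X c" if "x \<in> X" for x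
    using that closure_space_extensive[OF assms, of "{x}"] by (auto simp: VR_def)
  moreover have "\<tau> \<in> VR X c" if "\<sigma> \<in> VR X c" "\<tau> \<noteq> {}" "\<tau> \<subseteq> \<sigma>" for \<sigma> \<tau>
    using that finite_subset[of \<tau> \<sigma>] unfolding VR_def by blast
  moreover have "\<sigma> \<noteq> {} \<and> finite \<sigma> \<and> \<sigma> \<subseteq> X" if "\<sigma> \<in> VR X c" for \<sigma>
    using that unfolding VR_def by blast
  ultimately show ?thesis
    unfolding simplicial_complex_def by blast
qed

section \<open>The equivalence of the two conditions on a map, and the bijection of hom-sets\<close>

lemma closure_continuous_St_iff_simplicial_map_VR:
  assumes E: "simplicial_complex X E" and c: "closure_space Y c"
  shows "closure_continuous X (St X E) Y c f \<longleftrightarrow> simplicial_map X E Y (VR Y c) f"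
proof
  assume cont: "closure_continuous X (St X E) Y c f"
  then have f: "f \<in> X \<rightarrow> Y"
    unfolding closure_continuous_def by blast
  have "f ` \<sigma> \<in> VR Y c" if \<sigma>: "\<sigma> \<in> E" for \<sigma>
  proof -
    have sig: "\<sigma> \<noteq> {}" "finite \<sigma>" "\<sigma> \<subseteq> X"
      using E \<sigma> unfolding simplicial_complex_def by blast+
    have "f ` \<sigma> \<subseteq> c {f x}" if x: "x \<in> \<sigma>" for x
    proof -
      have "\<sigma> \<subseteq> St X E {x}"
        using x \<sigma> sig(3) mem_St_iff[of "{x}" X _ E] by blast
      moreover have "f ` St X E {x} \<subseteq> c (f ` {x})"
        using cont x sig(3) unfolding closure_continuous_def by blast
      ultimately show ?thesis by auto
    qed
    then show ?thesis
      using sig f unfolding VR_def by blast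
  qed
  with f show "simplicial_map X E Y (VR Y c) f"
    unfolding simplicial_map_def by blast
next
  assume simp: "simplicial_map X E Y (VR Y c) f"
  then have f: "f \<in> X \<rightarrow> Y"
    unfolding simplicial_map_def by blast
  have "f y \<in> c (f ` A)" if A: "A \<subseteq> X" and y: "y \<in> St X E A" for A y
  proof -
    obtain \<sigma> x where \<sigma>: "\<sigma> \<in> E" "y \<in> \<sigma>" "x \<in> \<sigma>" "x \<in> A"
      using y A by (auto simp: mem_St_iff)
    have "f ` \<sigma> \<in> VR Y c"
      using simp \<sigma>(1) unfolding simplicial_map_def by blast
    then have "f y \<in> c {f x}"
      using \<sigma>(2,3) unfolding VR_def by blast
    moreover have "c {f x} \<subseteq> c (f ` A)"
      using \<sigma>(4) A f by (intro closure_space_mono[OF c]) auto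
    ultimately show ?thesis by blast
  qed
  with f show "closure_continuous X (St X E) Y c f"
    unfolding closure_continuous_def by blast
qed

text \<open>Both sides consist of functions extensional on the same carrier X, because
  \<open>St_ob\<close> and \<open>VR_ob\<close> leave carriers alone. The equivalence therefore
  makes the hom-sets equal, and the comparison map is the identity of a single set.\<close>

lemma Cl_hom_St_ob_eq_Simp_hom_VR_ob:
  assumes "simplicial_complex X E" "closure_space Y c"
  shows "Cl_hom (St_ob (X, E)) (Y, c) = Simp_hom (X, E) (VR_ob (Y, c))"
  unfolding Cl_hom_def Simp_hom_def St_ob_def VR_ob_def
  using closure_continuous_St_iff_simplicial_map_VR[OF assms] by simp

lemma bij_betw_St_VR_iso:
  assumes "simplicial_complex X E" "closure_space Y c"
  shows "bij_betw (St_VR_iso (X, E) (Y, c))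
    (Cl_hom (St_ob (X, E)) (Y, c)) (Simp_hom (X, E) (VR_ob (Y, c)))"
  unfolding Cl_hom_St_ob_eq_Simp_hom_VR_ob[OF assms]
  by (auto simp: bij_betw_def inj_on_def St_VR_iso_def)

section \<open>The action of \<open>St\<close> and \<open>VR\<close> on maps\<close>

lemma closure_continuous_St:
  assumes "simplicial_map X E Y F f"
  shows "closure_continuous X (St X E) Y (St Y F) f"
  unfolding closure_continuous_def
proof (intro conjI allI impI image_subsetI)
  show f: "f \<in> X \<rightarrow> Y"
    using assms unfolding simplicial_map_def by blast
  fix A y assume A: "A \<subseteq> X" and "y \<in> St X E A"
  then obtain \<sigma> where \<sigma>: "\<sigma> \<in> E" "y \<in> \<sigma>" "\<sigma> \<inter> A \<noteq> {}"
    by (auto simp: mem_St_iff)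
  \<comment> \<open>A simplex through y that meets A is sent to a simplex through f y that meets
    f(A).\<close>
  then have "f ` \<sigma> \<in> F" "f y \<in> f ` \<sigma>" "f ` \<sigma> \<inter> f ` A \<noteq> {}"
    using assms unfolding simplicial_map_def by blast+
  moreover have "f ` A \<subseteq> Y"
    using f A by blast
  ultimately show "f y \<in> St Y F (f ` A)"
    by (auto simp only: mem_St_iff)
qed

text \<open>Continuity is applied only to singletons: \<sigma> lies in c(x) for each vertex x, so
  its image lies in d(f x), and every vertex of the image has the form f x.\<close>

lemma simplicial_map_VR:
  assumes "closure_continuous X c Y d f"
  shows "simplicial_map X (VR X c) Y (VR Y d) f"
  unfolding simplicial_map_def
proof (intro conjI ballI)
  show f: "f \<in> X \<rightarrow> Y"
    using assms unfolding closure_continuous_def by blast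
  fix \<sigma> assume \<sigma>: "\<sigma> \<in> VR X c"
  have "f ` \<sigma> \<subseteq> d {f x}" if "x \<in> \<sigma>" for x
  proof -
    have "\<sigma> \<subseteq> c {x}" "{x} \<subseteq> X"
      using \<sigma> that unfolding VR_def by blast+
    moreover from this have "f ` c {x} \<subseteq> d (f ` {x})"
      using assms unfolding closure_continuous_def by blast
    ultimately show ?thesis by auto
  qed
  then show "f ` \<sigma> \<in> VR Y d"
    using \<sigma> f unfolding VR_def by blast
qed

section \<open>The categories \<open>Cl\<close> and \<open>Simp\<close>\<close>

lemma is_category_of_maps:
  assumes maps: "\<And>P Q. H P Q \<subseteq> extensional (fst P) \<inter> (fst P \<rightarrow> fst Q)"
    and ident: "\<And>P. P \<in> S \<Longrightarrow> (\<lambda>x\<in>fst P. x) \<in> H P P"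
    and comp: "\<And>P Q R f g. P \<in> S \<Longrightarrow> f \<in> H P Q \<Longrightarrow> g \<in> H Q R \<Longrightarrow> compose (fst P) g f \<in> H P R"
  shows "is_category \<lparr>Ob = S, Hom = H, Ident = (\<lambda>P. \<lambda>x\<in>fst P. x),
    Comp = (\<lambda>P Q R g f. compose (fst P) g f)\<rparr>"
proof -
  \<comment> \<open>The unit and associativity laws follow from morphisms being extensional maps
    between carriers, so they are settled here for both categories at once.\<close>
  have "compose (fst P) f (\<lambda>x\<in>fst P. x) = f" "compose (fst P) (\<lambda>x\<in>fst Q. x) f = f"
    if "f \<in> H P Q" for P Q f
  proof -
    have f: "f \<in> extensional (fst P)" "f \<in> fst P \<rightarrow> fst Q"
      using maps[of P Q] that by blast+
    show "compose (fst P) f (\<lambda>x\<in>fst P. x) = f"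
      using f by (intro compose_Id)
    show "compose (fst P) (\<lambda>x\<in>fst Q. x) f = f"
      using f(2,1) by (rule Id_compose)
  qed
  moreover have "compose (fst P) (compose (fst Q) h g) f = compose (fst P) h (compose (fst P) g f)"
    if "f \<in> H P Q" for P Q f g h
    using maps[of P Q] that by (intro compose_assoc[symmetric]) blast
  ultimately show ?thesis
    unfolding is_category_def by (auto simp: ident comp)
qed

text \<open>The function \<open>compose X g f\<close> agrees with the plain composite on X only.
  That the source is a closure space ensures that c(A) stays inside X, where the two can be
  exchanged.\<close>

lemma closure_continuous_compose:
  assumes c: "closure_space X c"
    and f: "closure_continuous X c Y d f" and g: "closure_continuous Y d Z e g"
  shows "closure_continuous X c Z e (compose X g f)"
  unfolding closure_continuous_def
proof (intro conjI allI impI)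
  have maps: "f \<in> X \<rightarrow> Y" "g \<in> Y \<rightarrow> Z"
    using f g unfolding closure_continuous_def by blast+
  then show "compose X g f \<in> X \<rightarrow> Z"
    by (rule funcset_compose)
  fix A assume A: "A \<subseteq> X"
  have image: "compose X g f ` B = g ` f ` B" if "B \<subseteq> X" for B
    using that by (auto simp: compose_def subset_iff image_iff)
  have "g ` f ` c A \<subseteq> g ` d (f ` A)"
    using f A unfolding closure_continuous_def by blast
  also have "\<dots> \<subseteq> e (g ` f ` A)"
  proof -
    have "f ` A \<subseteq> Y"
      using maps A by blast
    then show ?thesis
      using g unfolding closure_continuous_def by blast
  qed
  finally show "compose X g f ` c A \<subseteq> e (compose X g f ` A)"
    using image[OF A] image[OF closure_space_subset[OF c A]] by simp
qed

text \<open>Here the simplices of the source lie in X, so the restricted composite acts on them as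
  the plain one.\<close>

lemma simplicial_map_compose:
  assumes E: "simplicial_complex X E"
    and f: "simplicial_map X E Y F f" and g: "simplicial_map Y F Z G g"
  shows "simplicial_map X E Z G (compose X g f)"
  unfolding simplicial_map_def
proof (intro conjI ballI)
  show "compose X g f \<in> X \<rightarrow> Z"
    using f g funcset_compose[of f X Y g Z] unfolding simplicial_map_def by blast
  fix \<sigma> assume \<sigma>: "\<sigma> \<in> E"
  then have "\<sigma> \<subseteq> X"
    using E unfolding simplicial_complex_def by blast
  then have "compose X g f ` \<sigma> = g ` f ` \<sigma>"
    by (auto simp: compose_def subset_iff image_iff)
  then show "compose X g f ` \<sigma> \<in> G"
    using f g \<sigma> unfolding simplicial_map_def by simp
qed

text \<open>Used for identity morphisms: they fix every closure and every simplex, as these are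
  subsets of the carrier.\<close>

lemma restrict_id_image: "B \<subseteq> X \<Longrightarrow> (\<lambda>x\<in>X. x) ` B = B"
  by force

lemma is_category_Cl: "is_category Cl"
  unfolding Cl_def
proof (rule is_category_of_maps)
  show "Cl_hom P Q \<subseteq> extensional (fst P) \<inter> (fst P \<rightarrow> fst Q)" for P Q :: "'a clos"
    unfolding Cl_hom_def closure_continuous_def by blast
next
  fix P :: "'a clos"
  assume "P \<in> {(X, c). closure_space X c \<and> c \<in> extensional (Pow X)}"
  then have "closure_space (fst P) (snd P)" by auto
  then have "(\<lambda>x\<in>fst P. x) ` snd P A \<subseteq> snd P ((\<lambda>x\<in>fst P. x) ` A)" if "A \<subseteq> fst P" for A
    using that by (simp only: restrict_id_image closure_space_subset order_refl)
  then show "(\<lambda>x\<in>fst P. x) \<in> Cl_hom P P"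
    unfolding Cl_hom_def closure_continuous_def by auto
next
  fix P Q R :: "'a clos" and f g
  assume "P \<in> {(X, c). closure_space X c \<and> c \<in> extensional (Pow X)}"
    and f: "f \<in> Cl_hom P Q" and g: "g \<in> Cl_hom Q R"
  then have P: "closure_space (fst P) (snd P)" by auto
  show "compose (fst P) g f \<in> Cl_hom P R"
    using closure_continuous_compose[OF P] f g unfolding Cl_hom_def by fastforce
qed

lemma is_category_Simp: "is_category Simp"
  unfolding Simp_def
proof (rule is_category_of_maps)
  show "Simp_hom P Q \<subseteq> extensional (fst P) \<inter> (fst P \<rightarrow> fst Q)" for P Q :: "'a simp"
    unfolding Simp_hom_def simplicial_map_def by blast
next
  fix P :: "'a simp"
  assume "P \<in> {(X, E). simplicial_complex X E}"
  then have "simplicial_complex (fst P) (snd P)" by auto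
  then have "\<sigma> \<subseteq> fst P" if "\<sigma> \<in> snd P" for \<sigma>
    using that unfolding simplicial_complex_def by blast
  then have "(\<lambda>x\<in>fst P. x) ` \<sigma> \<in> snd P" if "\<sigma> \<in> snd P" for \<sigma>
    using that by (simp only: restrict_id_image)
  then show "(\<lambda>x\<in>fst P. x) \<in> Simp_hom P P"
    unfolding Simp_hom_def simplicial_map_def by auto
next
  fix P Q R :: "'a simp" and f g
  assume "P \<in> {(X, E). simplicial_complex X E}"
    and f: "f \<in> Simp_hom P Q" and g: "g \<in> Simp_hom Q R"
  then have P: "simplicial_complex (fst P) (snd P)" by auto
  show "compose (fst P) g f \<in> Simp_hom P R"
    using simplicial_map_compose[OF P] f g unfolding Simp_hom_def by fastforce
qed

section \<open>Functoriality and the adjunction\<close>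

lemma is_functor_St: "is_functor Simp Cl St_functor"
proof -
  \<comment> \<open>Objects of \<open>Cl\<close> must carry an extensional closure operator; this is
    why \<open>St\<close> is defined by restriction.\<close>
  have "St X E \<in> extensional (Pow X)" for X :: "'a set" and E
    unfolding St_def by simp
  then show ?thesis
    unfolding is_functor_def using is_category_Simp is_category_Cl
    by (auto simp: Simp_def Cl_def St_functor_def St_ob_def St_hom_def Simp_hom_def Cl_hom_def
        intro: closure_space_St closure_continuous_St)
qed

lemma is_functor_VR: "is_functor Cl Simp VR_functor"
  unfolding is_functor_def using is_category_Simp is_category_Cl
  by (auto simp: Simp_def Cl_def VR_functor_def VR_ob_def VR_hom_def Simp_hom_def Cl_hom_def
      intro: simplicial_complex_VR simplicial_map_VR)

lemma adjunction_St_VR: "adjunction Simp Cl St_functor VR_functor St_VR_iso"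
proof -
  have "bij_betw (St_VR_iso P Q) (Hom Cl (ob_map St_functor P) Q) (Hom Simp P (ob_map VR_functor Q))"
    if "P \<in> Ob Simp" "Q \<in> Ob Cl" for P :: "'a simp" and Q :: "'a clos"
    using that bij_betw_St_VR_iso
    by (auto simp: Simp_def Cl_def St_functor_def VR_functor_def)
  then show ?thesis
    unfolding adjunction_def using is_functor_St is_functor_VR
    \<comment> \<open>Once unfolded, both sides of the naturality equation are the same iterated
      \<open>compose\<close>, since the functors keep carriers and underlying maps.\<close>
    by (simp add: Simp_def Cl_def St_functor_def VR_functor_def St_ob_def St_hom_def VR_hom_def
        St_VR_iso_def)
qed

theorem theorem6p12:
  fixes X :: "'a set" and E :: "'a set set"
    and Y :: "'b set" and cY :: "'b set \<Rightarrow> 'b set"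
  assumes "simplicial_complex X E" and "closure_space Y cY"
  shows
    "(\<forall>f \<in> X \<rightarrow> Y. closure_continuous X (St X E) Y cY f \<longleftrightarrow> simplicial_map X E Y (VR Y cY) f) \<and>
     bij_betw (St_VR_iso (X, E) (Y, cY))
       (Cl_hom (St_ob (X, E)) (Y, cY)) (Simp_hom (X, E) (VR_ob (Y, cY))) \<and>
     (\<forall>(X' :: 'c set) E' (Y' :: 'd set) cY' h g f.
        simplicial_complex X' E' \<and> closure_space Y' cY' \<and>
        h \<in> Simp_hom (X', E') (X, E) \<and> g \<in> Cl_hom (Y, cY) (Y', cY') \<and>
        f \<in> Cl_hom (St_ob (X, E)) (Y, cY) \<longrightarrow>
        St_VR_iso (X', E') (Y', cY')
          (compose X' (compose X g f) (St_hom (X', E') (X, E) h)) =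
        compose X'
          (compose X (VR_hom (Y, cY) (Y', cY') g) (St_VR_iso (X, E) (Y, cY) f)) h) \<and>
     adjunction (Simp :: ('u simp, 'u \<Rightarrow> 'u) category) Cl St_functor VR_functor St_VR_iso"
  \<comment> \<open>The equivalence, the bijection and naturality are obtained for carriers in
    unrelated types. The adjunction is between categories whose carriers share one type.\<close>
  using closure_continuous_St_iff_simplicial_map_VR[OF assms] bij_betw_St_VR_iso[OF assms]
    adjunction_St_VR
  by (simp add: St_VR_iso_def St_hom_def VR_hom_def)

end
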